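(* Let $H$ be a real Hilbert space. If $\mathcal{A}:H\rightrightarrows H$ is maximal monotone with $0\in\mathrm{dom}(\mathcal{A})$, then $\mathcal{A}$ is truncately $R$-continuous at $0$.
   Context: $\mathrm{dom}(\mathcal{A})=\{x\in H:\mathcal{A}(x)\neq\emptyset\}$. $\mathcal{A}$ is monotone if $\langle x^*-y^*,x-y\rangle\ge0$ for all $x^*\in\mathcal{A}(x)$, $y^*\in\mathcal{A}(y)$, and maximal monotone if moreover its graph is not strictly contained in the graph of another monotone operator. $\mathbb{B}$ is the closed unit ball of $H$; $\mathbb{R}^+=[0,\infty)$. A set-valued operator $\mathcal{A}:H\rightrightarrows H$ with $0\in\mathrm{dom}(\mathcal{A})$ is called truncately $R$-continuous at $0$ if there exist $\sigma>0$ and a non-decreasing function $\rho:\mathbb{R}^+\to\mathbb{R}^+$ with $\lim_{r\to0^+}\rho(r)=\rho(0)=0$ such that $\mathcal{A}(x)\cap a\mathbb{B}\subset\mathcal{A}(0)+\rho(\Vert x\Vert)\mathbb{B}$ for all $x\in\sigma\mathbb{B}$, where $a=\inf_{y\in\mathcal{A}(0)}\Vert y\Vert$. *)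

theory Defs
  imports "HOL-Analysis.Analysis"
begin

definition op_dom :: "('a \<Rightarrow> 'b set) \<Rightarrow> 'a set" where
  "op_dom A = {x. A x \<noteq> {}}"

definition op_graph :: "('a \<Rightarrow> 'b set) \<Rightarrow> ('a \<times> 'b) set" where
  "op_graph A = {(x, u). u \<in> A x}"

definition monotone_op :: "('a::real_inner \<Rightarrow> 'a set) \<Rightarrow> bool" where
  "monotone_op A \<longleftrightarrow> (\<forall>x y. \<forall>u\<in>A x. \<forall>v\<in>A y. inner (u - v) (x - y) \<ge> 0)"

definition maximal_monotone_op :: "('a::real_inner \<Rightarrow> 'a set) \<Rightarrow> bool" where
  "maximal_monotone_op A \<longleftrightarrow>
     monotone_op A \<and> \<not> (\<exists>A'. monotone_op A' \<and> op_graph A \<subset> op_graph A')"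

text \<open>The sum of sets below is the Minkowski sum. A function from the nonnegative reals to
  themselves is a function \<open>\<rho>\<close> on all reals of which only the values on \<open>{0..}\<close> matter.\<close>

definition truncately_R_continuous_at_0 :: "('a::real_inner \<Rightarrow> 'a set) \<Rightarrow> bool" where
  "truncately_R_continuous_at_0 A \<longleftrightarrow>
     0 \<in> op_dom A \<and>
     (\<exists>\<sigma>>0. \<exists>\<rho> :: real \<Rightarrow> real.
        \<rho> \<in> {0..} \<rightarrow> {0..} \<and> mono_on {0..} \<rho> \<and> (\<rho> \<longlongrightarrow> 0) (at_right 0) \<and> \<rho> 0 = 0 \<and>
        (let a = (INF y\<in>A 0. norm y) in
         \<forall>x \<in> (\<lambda>z. \<sigma> *\<^sub>R z) ` cball 0 1.
           A x \<inter> (\<lambda>z. a *\<^sub>R z) ` cball 0 1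
             \<subseteq> A 0 + (\<lambda>z. \<rho> (norm x) *\<^sub>R z) ` cball 0 1))"

end

theory Submission
  imports Defs
begin

text \<open>
  By maximality \<open>A 0\<close> is the set of all \<open>w\<close> that satisfy \<open>inner y w \<le> inner y v\<close> for every \<open>v \<in> A y\<close>;
  it is closed and convex, so it has a point \<open>p\<close> of least norm \<open>a\<close>, and \<open>p\<close> is its only point in the
  ball of radius \<open>a\<close>. What has to be shown is that values \<open>u \<in> A x\<close> with \<open>norm u \<le> a\<close> tend to \<open>p\<close> in
  norm, uniformly, as \<open>x\<close> tends to \<open>0\<close>. Then
  \<open>\<rho> r = Sup {norm (u - p) | u \<in> A x, norm x \<le> r, norm u \<le> a}\<close> is a modulus as required.

  The usual argument is that a weak limit of such values lies in \<open>A 0\<close> and has norm at most \<open>a\<close>,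
  hence equals \<open>p\<close>, and that weak convergence together with convergence of the norms is strong
  convergence. Weak compactness is replaced here by nested closed convex sets. Monotonicity puts all
  the values above with \<open>norm x \<le> \<delta>\<close> into the closed convex set \<open>relaxed_value A a \<delta>\<close>, in which the
  inequalities that characterise \<open>A 0\<close> are relaxed by multiples of \<open>\<delta>\<close>. These sets shrink to \<open>{p}\<close> as
  \<open>\<delta>\<close> decreases to \<open>0\<close>. The parallelogram law turns this into convergence in norm: points of nearly
  minimal norm in the sets form a Cauchy sequence, whose limit can only be \<open>p\<close>
  (\<open>nested_convex_least_norm\<close>); so the least norms in the sets tend to \<open>a\<close>, and therefore the
  diameters tend to \<open>0\<close> (\<open>nested_convex_shrink_to_point\<close>).
\<close>

section \<open>Nested closed convex sets in a Hilbert space\<close>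

text \<open>The midpoint of \<open>u\<close> and \<open>v\<close> lies in \<open>K\<close>, so its norm is at least the distance of \<open>K\<close> from the
  origin; the rest is the parallelogram law.\<close>

lemma convex_dist_le_norm_excess:
  fixes u v :: "'a::real_inner"
  assumes "convex K" "u \<in> K" "v \<in> K" "norm u \<le> s" "norm v \<le> s"
  shows "(norm (u - v))\<^sup>2 \<le> 4 * (s\<^sup>2 - (infdist 0 K)\<^sup>2)"
proof -
  have "(1/2) *\<^sub>R u + (1/2) *\<^sub>R v \<in> K"
    using assms(1-3) by (intro convexD) auto
  then have mid: "(1/2) *\<^sub>R (u + v) \<in> K"
    by (simp add: scaleR_right_distrib)
  have "infdist 0 K \<le> norm ((1/2) *\<^sub>R (u + v))"
    using infdist_le[OF mid, of 0] by simp
  then have "2 * infdist 0 K \<le> norm (u + v)"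
    by simp
  then have "(2 * infdist 0 K)\<^sup>2 \<le> (norm (u + v))\<^sup>2"
    by (intro power_mono) (auto simp: infdist_nonneg)
  moreover have "(norm (u + v))\<^sup>2 + (norm (u - v))\<^sup>2 = 2 * (norm u)\<^sup>2 + 2 * (norm v)\<^sup>2"
    by (simp add: power2_norm_eq_inner inner_add inner_diff algebra_simps inner_commute)
  moreover have "(norm u)\<^sup>2 \<le> s\<^sup>2" "(norm v)\<^sup>2 \<le> s\<^sup>2"
    using assms(4,5) by (auto intro!: power_mono)
  ultimately show ?thesis
    by (simp add: power_mult_distrib)
qed

text \<open>The distances from the origin increase to a limit, so two points of nearly minimal norm in late
  sets are close by the previous lemma. For a constant sequence this is the existence of a point of
  least norm in a closed convex set.\<close>

lemma nested_convex_least_norm: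
  fixes K :: "nat \<Rightarrow> 'a::{real_inner, complete_space} set"
  assumes dec: "decseq K"
    and closed: "\<And>n. closed (K n)" and convex: "\<And>n. convex (K n)" and ne: "\<And>n. K n \<noteq> {}"
    and bdd: "\<And>n. infdist 0 (K n) \<le> R"
  obtains w where "\<And>n. w \<in> K n" "(\<lambda>n. infdist 0 (K n)) \<longlonglongrightarrow> norm w"
proof -
  define m where "m n = infdist 0 (K n)" for n
  have "incseq m"
    unfolding m_def incseq_def using dec ne by (auto intro!: infdist_mono simp: decseq_def)
  then obtain L where mL: "m \<longlonglongrightarrow> L" and m_le: "\<And>n. m n \<le> L"
    using bdd incseq_convergent[of m R] unfolding m_def by blast
  have "\<exists>u\<in>K n. norm u < m n + 1 / real (Suc n)" for n
  proof -
    have "Inf ((\<lambda>u. dist 0 u) ` K n) < m n + 1 / real (Suc n)"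
      using ne[of n] by (simp add: m_def infdist_notempty)
    then show ?thesis
      using ne[of n] cInf_lessD[of "(\<lambda>u. dist 0 u) ` K n"] by auto
  qed
  then obtain w where wK: "\<And>n. w n \<in> K n" and wn: "\<And>n. norm (w n) < m n + 1 / real (Suc n)"
    by metis
  define e where "e n = 4 * ((L + 1 / real (Suc n))\<^sup>2 - (m n)\<^sup>2)" for n
  have inv: "(\<lambda>n. 1 / real (Suc n)) \<longlonglongrightarrow> 0"
    using LIMSEQ_inverse_real_of_nat by (simp add: inverse_eq_divide)
  have "e \<longlonglongrightarrow> 4 * ((L + 0)\<^sup>2 - L\<^sup>2)"
    unfolding e_def by (intro tendsto_intros mL inv)
  then have e0: "e \<longlonglongrightarrow> 0"
    by simp
  have close: "(norm (w n - w k))\<^sup>2 \<le> e n" if "n \<le> k" for n k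
  proof -
    have "w k \<in> K n"
      using wK[of k] decseqD[OF dec that] by blast
    moreover have "norm (w n) \<le> L + 1 / real (Suc n)"
      using wn[of n] m_le[of n] by linarith
    moreover have "norm (w k) \<le> L + 1 / real (Suc n)"
    proof -
      have "1 / real (Suc k) \<le> 1 / real (Suc n)"
        using that by (intro divide_left_mono) auto
      then show ?thesis
        using wn[of k] m_le[of k] by linarith
    qed
    ultimately show ?thesis
      unfolding e_def m_def by (intro convex_dist_le_norm_excess convex wK)
  qed
  have "Cauchy w"
  proof (rule metric_CauchyI)
    fix \<epsilon> :: real
    assume "0 < \<epsilon>"
    then have "0 < (\<epsilon> / 2)\<^sup>2"
      by simp
    then obtain N where N: "e N < (\<epsilon> / 2)\<^sup>2"
      using order_tendstoD(2)[OF e0] eventually_happens' sequentially_bot by blast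
    have *: "dist (w N) (w k) < \<epsilon> / 2" if "N \<le> k" for k
      unfolding dist_norm
    proof (rule power_less_imp_less_base)
      show "(norm (w N - w k))\<^sup>2 < (\<epsilon> / 2)\<^sup>2"
        using close[OF that] N by linarith
    qed (use \<open>0 < \<epsilon>\<close> in simp)
    have "dist (w i) (w j) < \<epsilon>" if "N \<le> i" "N \<le> j" for i j
      using dist_triangle_half_r *[OF that(1)] *[OF that(2)] by blast
    then show "\<exists>N. \<forall>i\<ge>N. \<forall>j\<ge>N. dist (w i) (w j) < \<epsilon>"
      by blast
  qed
  then obtain l where l: "w \<longlonglongrightarrow> l"
    using Cauchy_convergent_iff convergent_def by blast
  show ?thesis
  proof (rule that)
    fix n
    have "eventually (\<lambda>k. w k \<in> K n) sequentially"
      using eventually_ge_at_top[of n]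
    proof (rule eventually_mono)
      show "w k \<in> K n" if "n \<le> k" for k
        using wK[of k] decseqD[OF dec that] by blast
    qed
    then show "l \<in> K n"
      using Lim_in_closed_set[OF closed _ _ l] by auto
  next
    have "(\<lambda>n. norm (w n)) \<longlonglongrightarrow> L"
    proof (rule tendsto_sandwich[OF _ _ mL])
      show "(\<lambda>n. m n + 1 / real (Suc n)) \<longlonglongrightarrow> L"
        using tendsto_add[OF mL inv] by simp
      show "eventually (\<lambda>n. m n \<le> norm (w n)) sequentially"
        using infdist_le[OF wK, of 0] by (simp add: m_def)
      show "eventually (\<lambda>n. norm (w n) \<le> m n + 1 / real (Suc n)) sequentially"
        by (intro always_eventually allI less_imp_le wn)
    qed
    then have "norm l = L"
      using tendsto_norm[OF l] LIMSEQ_unique by blast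
    then show "(\<lambda>n. infdist 0 (K n)) \<longlonglongrightarrow> norm l"
      using mL by (simp add: m_def[abs_def])
  qed
qed

text \<open>Closed balls in an infinite-dimensional space are not compact, and an arbitrary nested sequence
  of closed convex bounded sets with intersection \<open>{p}\<close> need not shrink to \<open>p\<close> in norm. They do here
  because \<open>p\<close> has the largest norm in all the sets: this squeezes all norms towards \<open>norm p\<close>.\<close>

lemma nested_convex_shrink_to_point:
  fixes K :: "nat \<Rightarrow> 'a::{real_inner, complete_space} set"
  assumes dec: "decseq K"
    and closed: "\<And>n. closed (K n)" and convex: "\<And>n. convex (K n)"
    and Int: "(\<Inter>n. K n) = {p}" and ball: "\<And>n. K n \<subseteq> cball 0 (norm p)"
    and "0 < \<epsilon>"
  shows "\<exists>n. \<forall>u\<in>K n. norm (u - p) < \<epsilon>"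
proof -
  have pK: "p \<in> K n" for n
    using Int by blast
  have "infdist 0 (K n) \<le> norm p" for n
    using infdist_le[OF pK, of 0 n] by simp
  then obtain w where "\<And>n. w \<in> K n" and lim: "(\<lambda>n. infdist 0 (K n)) \<longlonglongrightarrow> norm w"
    using nested_convex_least_norm[OF dec closed convex] pK by (metis empty_iff)
  then have "w = p"
    using Int by blast
  then have "(\<lambda>n. 4 * ((norm p)\<^sup>2 - (infdist 0 (K n))\<^sup>2)) \<longlonglongrightarrow> 4 * ((norm p)\<^sup>2 - (norm p)\<^sup>2)"
    using lim by (intro tendsto_intros) auto
  then have "(\<lambda>n. 4 * ((norm p)\<^sup>2 - (infdist 0 (K n))\<^sup>2)) \<longlonglongrightarrow> 0"
    by simp
  moreover have "0 < \<epsilon>\<^sup>2"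
    using \<open>0 < \<epsilon>\<close> by simp
  ultimately obtain n where n: "4 * ((norm p)\<^sup>2 - (infdist 0 (K n))\<^sup>2) < \<epsilon>\<^sup>2"
    using order_tendstoD(2) eventually_happens' sequentially_bot by blast
  have "norm (u - p) < \<epsilon>" if "u \<in> K n" for u
  proof -
    have "norm u \<le> norm p"
      using ball[of n] that by auto
    then have "(norm (u - p))\<^sup>2 < \<epsilon>\<^sup>2"
      using convex_dist_le_norm_excess[OF convex that pK] n by fastforce
    then show ?thesis
      using \<open>0 < \<epsilon>\<close> by (auto intro: power_less_imp_less_base)
  qed
  then show ?thesis
    by blast
qed

section \<open>The value of a maximal monotone operator at the origin\<close>

lemma maximal_monotone_op_memI:
  assumes max: "maximal_monotone_op A"
    and rel: "\<And>y v. v \<in> A y \<Longrightarrow> 0 \<le> inner (u - v) (x - y)"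
  shows "u \<in> A x"
proof (rule ccontr)
  assume "u \<notin> A x"
  define A' where "A' = A(x := insert u (A x))"
  have "monotone_op A"
    using max by (simp add: maximal_monotone_op_def)
  then have mono: "0 \<le> inner (s - t) (y - z)" if "s \<in> A y" "t \<in> A z" for s t y z
    using that by (auto simp: monotone_op_def)
  have rel': "0 \<le> inner (v - u) (y - x)" if "v \<in> A y" for y v
    using rel[OF that] by (simp add: inner_diff algebra_simps)
  have "monotone_op A'"
    unfolding monotone_op_def A'_def by (auto simp: mono rel rel' split: if_splits)
  moreover have "op_graph A \<subset> op_graph A'"
    using \<open>u \<notin> A x\<close> by (force simp: op_graph_def A'_def)
  ultimately show False
    using max by (auto simp: maximal_monotone_op_def)
qed

lemma maximal_monotone_op_value_0:
  assumes "maximal_monotone_op A"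
  shows "A 0 = (\<Inter>(y, v)\<in>op_graph A. {w. inner y w \<le> inner y v})"
proof
  show "A 0 \<subseteq> (\<Inter>(y, v)\<in>op_graph A. {w. inner y w \<le> inner y v})"
    using assms
    by (force simp: maximal_monotone_op_def monotone_op_def op_graph_def inner_diff inner_commute)
  show "(\<Inter>(y, v)\<in>op_graph A. {w. inner y w \<le> inner y v}) \<subseteq> A 0"
    using maximal_monotone_op_memI[OF assms, of _ 0]
    by (fastforce simp: op_graph_def inner_diff inner_commute)
qed

lemma maximal_monotone_op_value_0_closed_convex:
  assumes "maximal_monotone_op A"
  shows "closed (A 0)" "convex (A 0)"
  unfolding maximal_monotone_op_value_0[OF assms]
  by (auto intro!: closed_INT convex_INT closed_halfspace_le convex_halfspace_le)

text \<open>The slack \<open>(R + norm v) * \<delta>\<close> bounds \<open>inner (u - v) x\<close> when \<open>norm u \<le> R\<close> and \<open>norm x \<le> \<delta>\<close>, which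
  is the error made on replacing \<open>x\<close> by \<open>0\<close> in the monotonicity inequality.\<close>

definition relaxed_value :: "('a::real_inner \<Rightarrow> 'a set) \<Rightarrow> real \<Rightarrow> real \<Rightarrow> 'a set" where
  "relaxed_value A R \<delta> =
     cball 0 R \<inter> (\<Inter>(y, v)\<in>op_graph A. {w. inner y w \<le> inner y v + (R + norm v) * \<delta>})"

lemma relaxed_value_closed_convex: "closed (relaxed_value A R \<delta>)" "convex (relaxed_value A R \<delta>)"
  unfolding relaxed_value_def
  by (auto intro!: closed_Int closed_INT convex_Int convex_INT closed_halfspace_le
      convex_halfspace_le)

lemma mem_relaxed_value:
  assumes mono: "monotone_op A" and u: "u \<in> A x" "norm u \<le> R" and x: "norm x \<le> \<delta>"
  shows "u \<in> relaxed_value A R \<delta>"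
proof -
  have "inner y u \<le> inner y v + (R + norm v) * \<delta>" if "v \<in> A y" for y v
  proof -
    have "0 \<le> inner (u - v) (x - y)"
      using mono u(1) that by (auto simp: monotone_op_def)
    then have "inner y u - inner y v \<le> inner (u - v) x"
      by (simp add: inner_diff inner_commute algebra_simps)
    also have "\<dots> \<le> norm (u - v) * norm x"
      by (rule norm_cauchy_schwarz)
    also have "\<dots> \<le> (R + norm v) * \<delta>"
    proof (rule mult_mono)
      show "norm (u - v) \<le> R + norm v"
        using norm_triangle_ineq4[of u v] u(2) by linarith
      show "0 \<le> R + norm v"
        using u(2) norm_ge_zero[of u] norm_ge_zero[of v] by linarith
    qed (use x in auto)
    finally show ?thesis
      by simp
  qed
  then show ?thesis
    using u(2) by (auto simp: relaxed_value_def op_graph_def)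
qed

lemma relaxed_value_mono:
  assumes "0 \<le> R" "\<delta> \<le> \<delta>'"
  shows "relaxed_value A R \<delta> \<subseteq> relaxed_value A R \<delta>'"
proof -
  have "(R + norm v) * \<delta> \<le> (R + norm v) * \<delta>'" for v :: 'a
    using assms by (intro mult_left_mono) auto
  then show ?thesis
    unfolding relaxed_value_def by (force intro: order_trans)
qed

lemma relaxed_value_Inter:
  assumes max: "maximal_monotone_op A" and "0 \<le> R"
  shows "(\<Inter>n. relaxed_value A R (1 / real (Suc n))) = A 0 \<inter> cball 0 R"
proof
  show "A 0 \<inter> cball 0 R \<subseteq> (\<Inter>n. relaxed_value A R (1 / real (Suc n)))"
    using max by (auto simp: maximal_monotone_op_def intro!: mem_relaxed_value[where x = 0])
  have "w \<in> A 0" if w: "\<And>n. w \<in> relaxed_value A R (1 / real (Suc n))" for w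
  proof -
    have "inner y w \<le> inner y v" if "(y, v) \<in> op_graph A" for y v
    proof (rule LIMSEQ_le_const)
      have "(\<lambda>n. inner y v + (R + norm v) * inverse (real (Suc n)))
          \<longlonglongrightarrow> inner y v + (R + norm v) * 0"
        by (intro tendsto_intros LIMSEQ_inverse_real_of_nat)
      then show "(\<lambda>n. inner y v + (R + norm v) * (1 / real (Suc n))) \<longlonglongrightarrow> inner y v"
        by (simp add: inverse_eq_divide)
      show "\<exists>N. \<forall>n\<ge>N. inner y w \<le> inner y v + (R + norm v) * (1 / real (Suc n))"
        using w that unfolding relaxed_value_def by blast
    qed
    then show ?thesis
      unfolding maximal_monotone_op_value_0[OF max] by auto
  qed
  then show "(\<Inter>n. relaxed_value A R (1 / real (Suc n))) \<subseteq> A 0 \<inter> cball 0 R"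
    by (auto simp: relaxed_value_def)
qed

section \<open>Continuity of the truncated values at the origin\<close>

lemma scaled_unit_ball:
  fixes r :: real
  assumes "0 \<le> r"
  shows "(\<lambda>z::'a::real_normed_vector. r *\<^sub>R z) ` cball 0 1 = cball 0 r"
proof (cases "r = 0")
  case False
  have "z \<in> (\<lambda>z::'a. r *\<^sub>R z) ` cball 0 1" if "norm z \<le> r" for z
    using that False assms by (intro image_eqI[of _ _ "(1 / r) *\<^sub>R z"]) (auto simp: field_simps)
  moreover have "norm (r *\<^sub>R z) \<le> r" if "norm z \<le> 1" for z :: 'a
    using that assms by (simp add: mult_left_le)
  ultimately show ?thesis
    by auto
qed (auto simp: image_constant_conv)

lemma maximal_monotone_op_least_norm_value_0:
  fixes A :: "'a::{real_inner, complete_space} \<Rightarrow> 'a set"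
  assumes max: "maximal_monotone_op A" and "A 0 \<noteq> {}"
  obtains p where "norm p = (INF y\<in>A 0. norm y)" "A 0 \<inter> cball 0 (norm p) = {p}"
proof -
  note cc = maximal_monotone_op_value_0_closed_convex[OF max]
  obtain p where p: "p \<in> A 0" and "(\<lambda>n::nat. infdist 0 (A 0)) \<longlonglongrightarrow> norm p"
    using nested_convex_least_norm[of "\<lambda>n. A 0" "infdist 0 (A 0)"] cc assms(2)
    by (auto simp: decseq_def)
  then have np: "norm p = infdist 0 (A 0)"
    using LIMSEQ_unique tendsto_const by blast
  have "u = p" if "u \<in> A 0" "norm u \<le> norm p" for u
    using convex_dist_le_norm_excess[OF cc(2) that(1) p that(2) order_refl] np by simp
  then have "A 0 \<inter> cball 0 (norm p) = {p}"
    using p by auto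
  moreover have "norm p = (INF y\<in>A 0. norm y)"
    using np assms(2) by (simp add: infdist_notempty)
  ultimately show ?thesis
    using that by blast
qed

lemma maximal_monotone_op_truncated_value_close:
  fixes A :: "'a::{real_inner, complete_space} \<Rightarrow> 'a set"
  assumes max: "maximal_monotone_op A" and p: "A 0 \<inter> cball 0 (norm p) = {p}" and "0 < \<epsilon>"
  shows "\<exists>\<delta>>0. \<forall>x u. norm x \<le> \<delta> \<longrightarrow> u \<in> A x \<longrightarrow> norm u \<le> norm p \<longrightarrow> norm (u - p) < \<epsilon>"
proof -
  have "\<exists>n. \<forall>u\<in>relaxed_value A (norm p) (1 / real (Suc n)). norm (u - p) < \<epsilon>"
  proof (rule nested_convex_shrink_to_point)
    show "decseq (\<lambda>n. relaxed_value A (norm p) (1 / real (Suc n)))"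
      unfolding decseq_def by (intro allI impI relaxed_value_mono divide_left_mono) auto
    show "(\<Inter>n. relaxed_value A (norm p) (1 / real (Suc n))) = {p}"
      using relaxed_value_Inter[OF max] p by simp
    show "relaxed_value A (norm p) (1 / real (Suc n)) \<subseteq> cball 0 (norm p)" for n
      by (auto simp: relaxed_value_def)
  qed (fact relaxed_value_closed_convex \<open>0 < \<epsilon>\<close>)+
  then obtain n where n: "\<forall>u\<in>relaxed_value A (norm p) (1 / real (Suc n)). norm (u - p) < \<epsilon>"
    by blast
  have "monotone_op A"
    using max by (simp add: maximal_monotone_op_def)
  then have "norm (u - p) < \<epsilon>"
    if "norm x \<le> 1 / real (Suc n)" "u \<in> A x" "norm u \<le> norm p" for x u
    using n mem_relaxed_value that by blast
  moreover have "0 < 1 / real (Suc n)"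
    by simp
  ultimately show ?thesis
    by blast
qed

theorem proposition2:
  fixes A :: "'a::{real_inner, complete_space} \<Rightarrow> 'a set"
  assumes "maximal_monotone_op A"
    and "0 \<in> op_dom A"
  shows "truncately_R_continuous_at_0 A"
proof -
  have "A 0 \<noteq> {}"
    using assms(2) by (simp add: op_dom_def)
  then obtain p where np: "norm p = (INF y\<in>A 0. norm y)" and p: "A 0 \<inter> cball 0 (norm p) = {p}"
    using maximal_monotone_op_least_norm_value_0[OF assms(1)] by blast
  define D where "D r = {norm (u - p) | u x. norm x \<le> r \<and> u \<in> A x \<and> norm u \<le> norm p}" for r :: real
  define \<rho> where "\<rho> r = Sup (D r)" for r
  have bdd: "bdd_above (D r)" for r
  proof (rule bdd_aboveI)
    fix d
    assume "d \<in> D r"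
    then obtain u where "d = norm (u - p)" "norm u \<le> norm p"
      by (auto simp: D_def)
    then show "d \<le> 2 * norm p"
      using norm_triangle_ineq4[of u p] by linarith
  qed
  \<comment> \<open>The pair \<open>x = 0\<close>, \<open>u = p\<close> always contributes, so the suprema are over nonempty sets.\<close>
  have zero: "0 \<in> D r" if "0 \<le> r" for r
    using p that unfolding D_def by force
  have nonneg: "0 \<le> \<rho> r" if "0 \<le> r" for r
    unfolding \<rho>_def using zero[OF that] bdd by (rule cSup_upper)
  have mono: "\<rho> r \<le> \<rho> s" if "0 \<le> r" "r \<le> s" for r s
    unfolding \<rho>_def
  proof (rule cSup_subset_mono)
    show "D r \<subseteq> D s"
      using that(2) unfolding D_def by force
  qed (use zero[OF that(1)] bdd in auto)
  have "D 0 = {0}"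
    using zero[of 0] p by (auto simp: D_def)
  then have \<rho>0: "\<rho> 0 = 0"
    by (simp add: \<rho>_def)
  have small: "\<exists>\<delta>>0. \<rho> \<delta> \<le> \<epsilon>" if \<epsilon>: "0 < \<epsilon>" for \<epsilon>
  proof -
    obtain \<delta> where "0 < \<delta>"
      and \<delta>: "\<And>x u. norm x \<le> \<delta> \<Longrightarrow> u \<in> A x \<Longrightarrow> norm u \<le> norm p \<Longrightarrow> norm (u - p) < \<epsilon>"
      using maximal_monotone_op_truncated_value_close[OF assms(1) p \<epsilon>] by blast
    have "\<rho> \<delta> \<le> \<epsilon>"
      unfolding \<rho>_def
    proof (rule cSup_least)
      show "D \<delta> \<noteq> {}"
        using zero[of \<delta>] \<open>0 < \<delta>\<close> by auto
    qed (use \<delta> in \<open>force simp: D_def\<close>)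
    then show ?thesis
      using \<open>0 < \<delta>\<close> by blast
  qed
  have lim: "(\<rho> \<longlongrightarrow> 0) (at_right 0)"
  proof (rule tendstoI)
    fix \<epsilon> :: real
    assume "0 < \<epsilon>"
    then obtain \<delta> where "0 < \<delta>" "\<rho> \<delta> \<le> \<epsilon> / 2"
      using small[of "\<epsilon> / 2"] by auto
    then have "dist (\<rho> r) 0 < \<epsilon>" if "0 < r" "r < \<delta>" for r
      using mono[of r \<delta>] nonneg[of r] that \<open>0 < \<epsilon>\<close> by simp
    then show "eventually (\<lambda>r. dist (\<rho> r) 0 < \<epsilon>) (at_right 0)"
      using \<open>0 < \<delta>\<close> by (auto simp: eventually_at_right)
  qed
  have incl: "A x \<inter> cball 0 (norm p) \<subseteq> A 0 + cball 0 (\<rho> (norm x))" for x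
  proof
    fix u
    assume "u \<in> A x \<inter> cball 0 (norm p)"
    then have "norm (u - p) \<in> D (norm x)"
      by (auto simp: D_def)
    then have "norm (u - p) \<le> \<rho> (norm x)"
      unfolding \<rho>_def using bdd by (rule cSup_upper)
    then have "p + (u - p) \<in> A 0 + cball 0 (\<rho> (norm x))"
      using p by (intro set_plus_intro) auto
    then show "u \<in> A 0 + cball 0 (\<rho> (norm x))"
      by simp
  qed
  show ?thesis
    unfolding truncately_R_continuous_at_0_def Let_def np[symmetric]
    \<comment> \<open>The estimate holds for all \<open>x\<close>, so any radius \<open>\<sigma>\<close> will do.\<close>
  proof (intro conjI assms(2) exI[of _ "1::real"] exI[of _ \<rho>] lim \<rho>0)
    show "\<rho> \<in> {0..} \<rightarrow> {0..}"
      using nonneg by auto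
    show "mono_on {0..} \<rho>"
      using mono by (auto intro!: mono_onI)
    show "\<forall>x\<in>(\<lambda>z. 1 *\<^sub>R z) ` cball 0 1. A x \<inter> (\<lambda>z. norm p *\<^sub>R z) ` cball 0 1
        \<subseteq> A 0 + (\<lambda>z. \<rho> (norm x) *\<^sub>R z) ` cball 0 1"
      using incl by (auto simp only: scaled_unit_ball norm_ge_zero nonneg)
  qed simp
qed

end
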